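(* Let $X$ be a manifold homotopically stratified space (MHSS), $Y$ a pure subset of $X$, and $N$ an approximate tubular neighborhood of $Y$ in $X$. Then $N$ is outwardly stratified tame.
   Context: A filtered space is a space $X$ with a finite filtration $X=X^n\supset X^{n-1}\supset\cdots\supset X^0\supset X^{-1}=\emptyset$; $X_i=X^i-X^{i-1}$ is the $i$th stratum. Subspaces carry the restricted filtration, and $Y\times\mathbb{R}$ has strata $Y_i\times\mathbb{R}$. A map $f:Z\times A\to X$ to a filtered space is stratum-preserving along $A$ if $f(\{z\}\times A)$ lies in a single stratum for each $z$; for $A=I=[0,1]$ (or $A=[0,\infty)$) it is called a stratum-preserving homotopy, and a homotopy $Z\times I\to X$ is nearly stratum-preserving if its restriction to $Z\times[0,1)$ is stratum-preserving along $[0,1)$. Outward tameness. A neighborhood $N$ of $Y$ is outwardly stratified tame if for any metric space $Z$ and proper map $f:Z\to N$ with $f(Z)\subset N-Y$, there exists a proper stratum-preserving homotopy $H:Z\times[0,\infty)\to N$ such that $H(Z\times[0,\infty))\subset N-Y$ and $H|_{Z\times0}=f$. (A map is proper if preimages of compact sets are compact.) MHSS. A subspace $Y$ of $X$ is forward tame in $X$ if there is a neighborhood $U$ of $Y$ and a nearly stratum-preserving deformation retraction $U\times I\to X$ of $U$ to $Y$ rel $Y$ (ending in $Y$ at time $1$). $\mathrm{holink}_s(X,Y)$ is the space (compact-open topology) of paths $\omega:I\to X$ with $\omega(0)\in Y$ and $\omega((0,1])$ contained in a single stratum of $X$ and in $X-Y$, stratified by the stratum containing $\omega(1)$; holink evaluation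 is $\omega\mapsto\omega(0)$. For $x\in X_i$, $\mathrm{holink}_s(X,x)\subset\mathrm{holink}_s(X,X_i)$ consists of paths with $\omega(0)=x$. $X$ is an MHSS if: $X$ is locally compact, separable and metric; it has finitely many strata and each $X_i$ is an $i$-manifold without boundary, locally closed in $X$; for each $k>i$, $X_i$ is forward tame in $X_i\cup X_k$; for each $k>i$, the evaluation $\mathrm{holink}_s(X_i\cup X_k,X_i)\to X_i$ is a fibration; and for each $x$ there is a stratum-preserving homotopy $\mathrm{holink}_s(X,x)\times I\to\mathrm{holink}_s(X,x)$ from the identity to a map into a compact subset. A pure subset is a closed subspace that is a union of components of strata. Approximate tubular neighborhoods. A manifold stratified approximate fibration (MSAF) is a proper map $q:A\to B$ between MHSSs such that for every space $Z$, map $f:Z\to A$ and stratum-preserving homotopy $F:Z\times I\to B$ with $F(z,0)=qf(z)$, there is a map $\tilde F:Z\times I\times[0,1)\to A$, stratum-preserving along $I\times[0,1)$, with $\tilde F(z,0,t)=f(z)$, such that $\bar F:Z\times I\times I\to B$ defined by $\bar F|_{Z\times I\times[0,1)}=q\tilde F$ and $\bar F|_{Z\times I\times\{1\}}=F$ is continuous. For a map $p:W\to Y\times\mathbb{R}$, the teardrop $W\cup_pY$ is the set $W\amalg Y$ with the minimal topology such that $W\hookrightarrow W\cup_pY$ is an open embedding and the function $c:W\cup_pY\to Y\times(-\infty,\infty]$, $c(x)=p(x)$ for $x\in W$, $c(y)=(y,\infty)$ for $y\in Y$, is continuous. A neighborhood $N$ of the pure subset $Y$ in $X$ is an approximate tubular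 neighborhood if there is an MSAF $p:N-Y\to Y\times\mathbb{R}$ such that the teardrop $(N-Y)\cup_pY$ is homeomorphic to $N$ (via the natural identification of underlying sets). *)

theory Defs
  imports "HOL-Analysis.Analysis"
begin

section \<open>Filtered spaces\<close>

text \<open>A filtration is indexed by all natural numbers; it is finite in that it reaches the whole
  space (and is constant from there on). The convention that the filtration is empty in
  degree -1 is built into the definition of the strata.\<close>

definition filtered_space :: "'a topology \<Rightarrow> (nat \<Rightarrow> 'a set) \<Rightarrow> bool" where
  "filtered_space X F \<longleftrightarrow>
     (\<forall>i. F i \<subseteq> F (Suc i)) \<and> (\<forall>i. F i \<subseteq> topspace X) \<and> (\<exists>n. F n = topspace X)"

definition stratum :: "(nat \<Rightarrow> 'a set) \<Rightarrow> nat \<Rightarrow> 'a set" where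
  "stratum F i = F i - (case i of 0 \<Rightarrow> {} | Suc j \<Rightarrow> F j)"

definition restrict_filtration :: "(nat \<Rightarrow> 'a set) \<Rightarrow> 'a set \<Rightarrow> (nat \<Rightarrow> 'a set)" where
  "restrict_filtration F S = (\<lambda>i. F i \<inter> S)"

text \<open>The strata of the product of a filtered space with the real line are the products of the
  strata with the line. The index goes up by one, so that strata which are manifolds are still
  indexed by their dimension.\<close>

definition times_line_filtration :: "(nat \<Rightarrow> 'a set) \<Rightarrow> (nat \<Rightarrow> ('a \<times> real) set)" where
  "times_line_filtration F = (\<lambda>i. case i of 0 \<Rightarrow> {} | Suc j \<Rightarrow> F j \<times> UNIV)"

lemma stratum_restrict_filtration: "stratum (restrict_filtration F S) i = stratum F i \<inter> S"
  by (auto simp: stratum_def restrict_filtration_def split: nat.splits)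

lemma stratum_times_line_filtration:
  "stratum (times_line_filtration F) 0 = {}"
  "stratum (times_line_filtration F) (Suc i) = stratum F i \<times> UNIV"
  by (auto simp: stratum_def times_line_filtration_def split: nat.splits)

definition stratum_preserving_along ::
    "'z set \<Rightarrow> 't set \<Rightarrow> (nat \<Rightarrow> 'a set) \<Rightarrow> ('z \<times> 't \<Rightarrow> 'a) \<Rightarrow> bool" where
  "stratum_preserving_along Z A F f \<longleftrightarrow> (\<forall>z\<in>Z. \<exists>i. f ` ({z} \<times> A) \<subseteq> stratum F i)"

abbreviation unit_interval :: "real topology" where
  "unit_interval \<equiv> top_of_set {0..1}"

definition stratum_preserving_homotopy ::
    "'z topology \<Rightarrow> 'a topology \<Rightarrow> (nat \<Rightarrow> 'a set) \<Rightarrow> ('z \<times> real \<Rightarrow> 'a) \<Rightarrow> bool" where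
  "stratum_preserving_homotopy Z X F h \<longleftrightarrow>
     continuous_map (prod_topology Z unit_interval) X h \<and>
     stratum_preserving_along (topspace Z) {0..1} F h"

definition nearly_stratum_preserving_homotopy ::
    "'z topology \<Rightarrow> 'a topology \<Rightarrow> (nat \<Rightarrow> 'a set) \<Rightarrow> ('z \<times> real \<Rightarrow> 'a) \<Rightarrow> bool" where
  "nearly_stratum_preserving_homotopy Z X F h \<longleftrightarrow>
     continuous_map (prod_topology Z unit_interval) X h \<and>
     stratum_preserving_along (topspace Z) {0..<1} F h"

definition is_neighborhood :: "'a topology \<Rightarrow> 'a set \<Rightarrow> 'a set \<Rightarrow> bool" where
  "is_neighborhood X Y N \<longleftrightarrow> N \<subseteq> topspace X \<and> (\<exists>U. openin X U \<and> Y \<subseteq> U \<and> U \<subseteq> N)"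


section \<open>Proper maps and outward tameness\<close>

text \<open>The library's \<^const>\<open>proper_map\<close> asks for closed maps with compact fibres; here a map is proper
  if preimages of compact sets are compact.\<close>

definition compact_preimage_map :: "'a topology \<Rightarrow> 'b topology \<Rightarrow> ('a \<Rightarrow> 'b) \<Rightarrow> bool" where
  "compact_preimage_map A B f \<longleftrightarrow>
     continuous_map A B f \<and> (\<forall>K. compactin B K \<longrightarrow> compactin A {x \<in> topspace A. f x \<in> K})"

text \<open>The metric space Z is carried by an arbitrary subset of the type \<^typ>\<open>'z\<close>; in a theorem
  this type is a free variable and thus universally quantified.\<close>

definition outwardly_stratified_tame ::
    "'z itself \<Rightarrow> 'a topology \<Rightarrow> (nat \<Rightarrow> 'a set) \<Rightarrow> 'a set \<Rightarrow> 'a set \<Rightarrow> bool" where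
  "outwardly_stratified_tame (_ :: 'z itself) X F Y N \<longleftrightarrow>
     is_neighborhood X Y N \<and>
     (\<forall>(Z :: 'z topology) f.
        metrizable_space Z \<and>
        compact_preimage_map Z (subtopology X N) f \<and>
        f ` topspace Z \<subseteq> N - Y \<longrightarrow>
        (\<exists>H. compact_preimage_map (prod_topology Z (top_of_set {0::real..})) (subtopology X N) H \<and>
             stratum_preserving_along (topspace Z) {0..} (restrict_filtration F N) H \<and>
             H ` (topspace Z \<times> {0..}) \<subseteq> N - Y \<and>
             (\<forall>z\<in>topspace Z. H (z, 0) = f z)))"


section \<open>Homotopy links\<close>

text \<open>Maps out of \<^term>\<open>A\<close> are represented by extensional functions, so that they are determined by
  their values on \<^term>\<open>topspace A\<close>.\<close>

definition compact_open_topology :: "'a topology \<Rightarrow> 'b topology \<Rightarrow> ('a \<Rightarrow> 'b) topology" where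
  "compact_open_topology A X = topology_generated_by
     {{f \<in> extensional (topspace A). continuous_map A X f \<and> f ` K \<subseteq> U} | K U.
        compactin A K \<and> openin X U}"

lemma topspace_compact_open_topology:
  "topspace (compact_open_topology A X) = {f \<in> extensional (topspace A). continuous_map A X f}"
proof -
  have "{f \<in> extensional (topspace A). continuous_map A X f} =
        {f \<in> extensional (topspace A). continuous_map A X f \<and> f ` {} \<subseteq> {}}"
    by auto
  then show ?thesis
    unfolding compact_open_topology_def topology_generated_by_topspace
    using compactin_empty[of A] openin_empty[of X] by blast
qed

definition holink :: "'a topology \<Rightarrow> (nat \<Rightarrow> 'a set) \<Rightarrow> 'a set \<Rightarrow> (real \<Rightarrow> 'a) topology" where
  "holink X F Y = subtopology (compact_open_topology unit_interval X)
     {\<omega>. \<omega> 0 \<in> Y \<and> (\<exists>j. \<omega> ` {0<..1} \<subseteq> stratum F j) \<and> \<omega> ` {0<..1} \<subseteq> topspace X - Y}"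

text \<open>A path lies in the j-th stratum of the homotopy link iff its end point lies in the j-th
  stratum of the space.\<close>

definition holink_filtration ::
    "'a topology \<Rightarrow> (nat \<Rightarrow> 'a set) \<Rightarrow> 'a set \<Rightarrow> (nat \<Rightarrow> (real \<Rightarrow> 'a) set)" where
  "holink_filtration X F Y = (\<lambda>j. {\<omega> \<in> topspace (holink X F Y). \<omega> 1 \<in> F j})"

text \<open>The local homotopy link at a point of the i-th stratum.\<close>

definition local_holink ::
    "'a topology \<Rightarrow> (nat \<Rightarrow> 'a set) \<Rightarrow> nat \<Rightarrow> 'a \<Rightarrow> (real \<Rightarrow> 'a) topology" where
  "local_holink X F i x = subtopology (holink X F (stratum F i)) {\<omega>. \<omega> 0 = x}"

definition local_holink_filtration ::
    "'a topology \<Rightarrow> (nat \<Rightarrow> 'a set) \<Rightarrow> nat \<Rightarrow> 'a \<Rightarrow> (nat \<Rightarrow> (real \<Rightarrow> 'a) set)" where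
  "local_holink_filtration X F i x =
     restrict_filtration (holink_filtration X F (stratum F i)) {\<omega>. \<omega> 0 = x}"


section \<open>Fibrations\<close>

definition homotopy_lifting_wrt ::
    "'z topology \<Rightarrow> 'e topology \<Rightarrow> 'b topology \<Rightarrow> ('e \<Rightarrow> 'b) \<Rightarrow> bool" where
  "homotopy_lifting_wrt Z E B p \<longleftrightarrow>
     (\<forall>f H. continuous_map Z E f \<and>
            continuous_map (prod_topology Z unit_interval) B H \<and>
            (\<forall>z\<in>topspace Z. H (z, 0) = p (f z)) \<longrightarrow>
        (\<exists>G. continuous_map (prod_topology Z unit_interval) E G \<and>
             (\<forall>z\<in>topspace Z. G (z, 0) = f z) \<and>
             (\<forall>z\<in>topspace Z. \<forall>s\<in>{0..1}. p (G (z, s)) = H (z, s))))"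

text \<open>A definition cannot quantify over the type carrying the test space Z. The type below is large
  enough for the definition to cover all test spaces over all types, as proved in
  \<open>hurewicz_fibrationD\<close>.\<close>

definition hurewicz_fibration :: "'e topology \<Rightarrow> 'b topology \<Rightarrow> ('e \<Rightarrow> 'b) \<Rightarrow> bool" where
  "hurewicz_fibration E B p \<longleftrightarrow>
     continuous_map E B p \<and>
     (\<forall>Z :: ('e \<times> (real \<Rightarrow> 'b)) topology. homotopy_lifting_wrt Z E B p)"


section \<open>Manifold homotopically stratified spaces\<close>

definition topological_manifold :: "nat \<Rightarrow> 'a topology \<Rightarrow> bool" where
  "topological_manifold n M \<longleftrightarrow>
     Hausdorff_space M \<and> second_countable M \<and>
     (\<forall>x\<in>topspace M. \<exists>U. openin M U \<and> x \<in> U \<and>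
        subtopology M U homeomorphic_space Euclidean_space n)"

definition locally_closedin :: "'a topology \<Rightarrow> 'a set \<Rightarrow> bool" where
  "locally_closedin X S \<longleftrightarrow> (\<exists>U C. openin X U \<and> closedin X C \<and> S = U \<inter> C)"

definition forward_tame :: "'a topology \<Rightarrow> (nat \<Rightarrow> 'a set) \<Rightarrow> 'a set \<Rightarrow> bool" where
  "forward_tame X F Y \<longleftrightarrow>
     (\<exists>U h. is_neighborhood X Y U \<and>
        nearly_stratum_preserving_homotopy (subtopology X U) X F h \<and>
        (\<forall>u\<in>U. h (u, 0) = u) \<and>
        (\<forall>u\<in>U. h (u, 1) \<in> Y) \<and>
        (\<forall>y\<in>Y. \<forall>t\<in>{0..1}. h (y, t) = y))"

definition mhss :: "'a topology \<Rightarrow> (nat \<Rightarrow> 'a set) \<Rightarrow> bool" where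
  "mhss X F \<longleftrightarrow>
     filtered_space X F \<and>
     locally_compact_space X \<and> separable_space X \<and> metrizable_space X \<and>
     (\<forall>i. topological_manifold i (subtopology X (stratum F i)) \<and>
          locally_closedin X (stratum F i)) \<and>
     (\<forall>i k. i < k \<longrightarrow>
        (let S = stratum F i \<union> stratum F k; XS = subtopology X S; FS = restrict_filtration F S in
           forward_tame XS FS (stratum F i) \<and>
           hurewicz_fibration (holink XS FS (stratum F i)) (subtopology X (stratum F i))
             (\<lambda>\<omega>. \<omega> 0))) \<and>
     (\<forall>i. \<forall>x\<in>stratum F i.
        \<exists>h K. stratum_preserving_homotopy (local_holink X F i x) (local_holink X F i x)
                (local_holink_filtration X F i x) h \<and>
              (\<forall>\<omega>\<in>topspace (local_holink X F i x). h (\<omega>, 0) = \<omega>) \<and>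
              compactin (local_holink X F i x) K \<and>
              (\<forall>\<omega>\<in>topspace (local_holink X F i x). h (\<omega>, 1) \<in> K))"

definition pure_subset :: "'a topology \<Rightarrow> (nat \<Rightarrow> 'a set) \<Rightarrow> 'a set \<Rightarrow> bool" where
  "pure_subset X F Y \<longleftrightarrow>
     closedin X Y \<and>
     (\<exists>\<C>. \<C> \<subseteq> (\<Union>i. connected_components_of (subtopology X (stratum F i))) \<and> Y = \<Union>\<C>)"


section \<open>Manifold stratified approximate fibrations\<close>

definition stratified_approximate_lifting_wrt ::
    "'z topology \<Rightarrow> 'a topology \<Rightarrow> (nat \<Rightarrow> 'a set) \<Rightarrow> 'b topology \<Rightarrow> (nat \<Rightarrow> 'b set) \<Rightarrow>
     ('a \<Rightarrow> 'b) \<Rightarrow> bool" where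
  "stratified_approximate_lifting_wrt Z A FA B FB q \<longleftrightarrow>
     (\<forall>f H. continuous_map Z A f \<and>
            stratum_preserving_homotopy Z B FB H \<and>
            (\<forall>z\<in>topspace Z. H (z, 0) = q (f z)) \<longrightarrow>
        (\<exists>G. continuous_map
                (prod_topology Z (prod_topology unit_interval (top_of_set {0..<1}))) A G \<and>
             stratum_preserving_along (topspace Z) ({0..1} \<times> {0..<1}) FA G \<and>
             (\<forall>z\<in>topspace Z. \<forall>t\<in>{0..<1}. G (z, 0, t) = f z) \<and>
             continuous_map
                (prod_topology Z (prod_topology unit_interval unit_interval)) B
                (\<lambda>(z, s, t). if t < 1 then q (G (z, s, t)) else H (z, s))))"

text \<open>As for fibrations, the type carrying the test spaces is large enough to cover test spaces over
  all types; see \<open>msaf_lifting\<close>.\<close>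

definition msaf ::
    "'a topology \<Rightarrow> (nat \<Rightarrow> 'a set) \<Rightarrow> 'b topology \<Rightarrow> (nat \<Rightarrow> 'b set) \<Rightarrow> ('a \<Rightarrow> 'b) \<Rightarrow> bool" where
  "msaf A FA B FB q \<longleftrightarrow>
     mhss A FA \<and> mhss B FB \<and> compact_preimage_map A B q \<and>
     (\<forall>Z :: ('a \<times> (real \<Rightarrow> 'b)) topology.
        stratified_approximate_lifting_wrt Z A FA B FB q)"


section \<open>Teardrops and approximate tubular neighborhoods\<close>

definition teardrop_collapse :: "('w \<Rightarrow> 'y \<times> real) \<Rightarrow> 'w + 'y \<Rightarrow> 'y \<times> ereal" where
  "teardrop_collapse p = case_sum (\<lambda>x. (fst (p x), ereal (snd (p x)))) (\<lambda>y. (y, \<infinity>))"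

definition teardrop :: "'w topology \<Rightarrow> 'y topology \<Rightarrow> ('w \<Rightarrow> 'y \<times> real) \<Rightarrow> ('w + 'y) topology" where
  "teardrop W Y p = topology_generated_by
     ({Inl ` U | U. openin W U} \<union>
      {{x \<in> topspace W <+> topspace Y. teardrop_collapse p x \<in> V} | V.
         openin (prod_topology Y (top_of_set {-\<infinity><..})) V})"

definition approximate_tubular_neighborhood ::
    "'a topology \<Rightarrow> (nat \<Rightarrow> 'a set) \<Rightarrow> 'a set \<Rightarrow> 'a set \<Rightarrow> bool" where
  "approximate_tubular_neighborhood X F Y N \<longleftrightarrow>
     is_neighborhood X Y N \<and>
     (\<exists>p. msaf (subtopology X (N - Y)) (restrict_filtration F (N - Y))
            (prod_topology (subtopology X Y) euclideanreal)
            (times_line_filtration (restrict_filtration F Y)) p \<and>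
          homeomorphic_map (teardrop (subtopology X (N - Y)) (subtopology X Y) p)
            (subtopology X N) (case_sum id id))"


section \<open>Justification of the encodings\<close>

text \<open>The topology of the teardrop is the minimal one among those for which the inclusion of W is an
  open embedding and the collapse is continuous.\<close>

lemma teardrop_collapse_in:
  assumes p: "continuous_map W (prod_topology Y euclideanreal) p" and "x \<in> topspace W <+> topspace Y"
  shows "teardrop_collapse p x \<in> topspace Y \<times> {-\<infinity><..}"
proof -
  have *: "fst (p w) \<in> topspace Y" if "w \<in> topspace W" for w
    using continuous_map_funspace[OF continuous_map_fst_of[OF p]] that by (simp add: Pi_iff)
  from assms(2) show ?thesis
  proof (elim PlusE)
    fix w assume "w \<in> topspace W" "x = Inl w"
    then show ?thesis using * by (simp add: teardrop_collapse_def)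
  next
    fix y assume "y \<in> topspace Y" "x = Inr y"
    then show ?thesis by (simp add: teardrop_collapse_def)
  qed
qed

lemma topspace_teardrop:
  assumes "continuous_map W (prod_topology Y euclideanreal) p"
  shows "topspace (teardrop W Y p) = topspace W <+> topspace Y"
proof -
  have "openin (prod_topology Y (top_of_set {-\<infinity><..})) (topspace Y \<times> {- (\<infinity>::ereal)<..})"
    by (metis openin_topspace topspace_prod_topology topspace_euclidean_subtopology)
  moreover have "{x \<in> topspace W <+> topspace Y. teardrop_collapse p x \<in> topspace Y \<times> {-\<infinity><..}} =
      topspace W <+> topspace Y"
    using teardrop_collapse_in[OF assms] by blast
  ultimately have "topspace W <+> topspace Y \<subseteq> topspace (teardrop W Y p)"
    unfolding teardrop_def topology_generated_by_topspace by blast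
  moreover have "topspace (teardrop W Y p) \<subseteq> topspace W <+> topspace Y"
    unfolding teardrop_def topology_generated_by_topspace
    by (auto dest: openin_subset)
  ultimately show ?thesis by blast
qed

lemma teardrop_properties:
  assumes p: "continuous_map W (prod_topology Y euclideanreal) p"
  shows "embedding_map W (teardrop W Y p) Inl" "open_map W (teardrop W Y p) Inl"
    and "continuous_map (teardrop W Y p) (prod_topology Y (top_of_set {-\<infinity><..}))
           (teardrop_collapse p)"
proof -
  let ?T = "teardrop W Y p" and ?B = "prod_topology Y (top_of_set {- (\<infinity>::ereal)<..})"
  have topB: "topspace ?B = topspace Y \<times> {-\<infinity><..}" by simp
  show om: "open_map W ?T Inl"
    unfolding open_map_def teardrop_def by (auto intro!: topology_generated_by_Basis)
  have cont: "continuous_map W ?B (\<lambda>x. (fst (p x), ereal (snd (p x))))"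
  proof (intro continuous_map_pairedI)
    show "continuous_map W Y (\<lambda>x. fst (p x))"
      using continuous_map_fst_of[OF p] by (simp add: o_def)
    have "continuous_map W euclideanreal (\<lambda>x. snd (p x))"
      using continuous_map_snd_of[OF p] by (simp add: o_def)
    moreover have "continuous_map euclideanreal euclidean ereal"
      by (auto intro!: continuous_intros)
    ultimately have "continuous_map W euclidean (\<lambda>x. ereal (snd (p x)))"
      using continuous_map_compose[of W euclideanreal "\<lambda>x. snd (p x)" euclidean ereal]
      by (simp add: o_def)
    then show "continuous_map W (top_of_set {-\<infinity><..}) (\<lambda>x. ereal (snd (p x)))"
      by (auto simp: continuous_map_in_subtopology)
  qed
  have "continuous_map W ?T Inl"
    unfolding teardrop_def
  proof (rule continuous_on_generated_topo)
    fix U assume "U \<in> {Inl ` U | U. openin W U} \<union>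
      {{x \<in> topspace W <+> topspace Y. teardrop_collapse p x \<in> V} | V. openin ?B V}"
    then consider (a) U' where "U = Inl ` U'" "openin W U'"
      | (b) V where "U = {x \<in> topspace W <+> topspace Y. teardrop_collapse p x \<in> V}" "openin ?B V"
      by blast
    then show "openin W (Inl -` U \<inter> topspace W)"
    proof cases
      case a
      then have "Inl -` U \<inter> topspace W = U'" by (auto dest: openin_subset)
      then show ?thesis using a by simp
    next
      case b
      then have "Inl -` U \<inter> topspace W = {x \<in> topspace W. (fst (p x), ereal (snd (p x))) \<in> V}"
        by (auto simp: teardrop_collapse_def)
      then show ?thesis using b openin_continuous_map_preimage[OF cont] by simp
    qed
  next
    show "Inl ` topspace W \<subseteq> \<Union> ({Inl ` U | U. openin W U} \<union>
      {{x \<in> topspace W <+> topspace Y. teardrop_collapse p x \<in> V} | V. openin ?B V})"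
      by blast
  qed
  then show "embedding_map W ?T Inl"
    using om injective_open_imp_embedding_map by (metis inj_Inl inj_on_subset subset_UNIV)
  show "continuous_map ?T ?B (teardrop_collapse p)"
    unfolding continuous_map_def topspace_teardrop[OF p]
  proof (intro conjI allI impI)
    show "teardrop_collapse p \<in> (topspace W <+> topspace Y) \<rightarrow> topspace ?B"
      unfolding topB using teardrop_collapse_in[OF p] by blast
    fix V assume "openin ?B V"
    then show "openin ?T {x \<in> topspace W <+> topspace Y. teardrop_collapse p x \<in> V}"
      unfolding teardrop_def by (intro topology_generated_by_Basis) blast
  qed
qed

lemma teardrop_minimal:
  assumes "topspace T = topspace W <+> topspace Y" "open_map W T Inl"
    and c: "continuous_map T (prod_topology Y (top_of_set {-\<infinity><..})) (teardrop_collapse p)"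
    and "openin (teardrop W Y p) U"
  shows "openin T U"
proof -
  let ?S = "{Inl ` U | U. openin W U} \<union>
      {{x \<in> topspace W <+> topspace Y. teardrop_collapse p x \<in> V} | V.
         openin (prod_topology Y (top_of_set {-\<infinity><..})) V}"
  have basis: "openin T S" if S: "S \<in> ?S" for S
    using S
  proof
    assume "S \<in> {Inl ` U | U. openin W U}"
    then show ?thesis using assms(2) unfolding open_map_def by blast
  next
    assume "S \<in> {{x \<in> topspace W <+> topspace Y. teardrop_collapse p x \<in> V} | V.
         openin (prod_topology Y (top_of_set {-\<infinity><..})) V}"
    then obtain V where V: "S = {x \<in> topspace W <+> topspace Y. teardrop_collapse p x \<in> V}"
      "openin (prod_topology Y (top_of_set {-\<infinity><..})) V" by blast
    show ?thesis
      using openin_continuous_map_preimage[OF c V(2)] unfolding V(1) assms(1) .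
  qed
  have gen: "generate_topology_on ?S U"
    using assms(4) unfolding teardrop_def by (rule openin_topology_generated_by)
  show ?thesis
    by (rule generate_topology_on_coarsest[where T = "openin T", OF _ basis gen]) simp
qed

text \<open>Every lifting problem factors through one whose test space is carried by the type of pairs of a
  point and a path: identify points of Z at which the two data of the problem agree.\<close>

lemma ex_quotient_topology:
  obtains Z' where "quotient_map Z Z' g" "topspace Z' = g ` topspace Z"
proof -
  define P where "P = (\<lambda>U. U \<subseteq> g ` topspace Z \<and> openin Z {z \<in> topspace Z. g z \<in> U})"
  have "istopology P"
    unfolding istopology_def
  proof (intro conjI allI impI)
    fix S T assume "P S" "P T"
    moreover have "{z \<in> topspace Z. g z \<in> S \<inter> T} =
        {z \<in> topspace Z. g z \<in> S} \<inter> {z \<in> topspace Z. g z \<in> T}" by auto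
    ultimately show "P (S \<inter> T)" unfolding P_def by auto
  next
    fix \<K> assume "\<forall>K\<in>\<K>. P K"
    moreover have "{z \<in> topspace Z. g z \<in> \<Union>\<K>} = (\<Union>K\<in>\<K>. {z \<in> topspace Z. g z \<in> K})" by auto
    ultimately show "P (\<Union>\<K>)" unfolding P_def by auto
  qed
  then have op: "openin (topology P) = P" by (simp add: topology_inverse')
  have "{z \<in> topspace Z. g z \<in> g ` topspace Z} = topspace Z" by blast
  then have "P (g ` topspace Z)" unfolding P_def by simp
  then have "topspace (topology P) = g ` topspace Z"
    by (metis P_def op openin_subset openin_topspace subset_antisym)
  moreover have "quotient_map Z (topology P) g"
    unfolding quotient_map_def op calculation by (auto simp: P_def)
  ultimately show ?thesis using that by blast
qed

lemma factor_lifting_problem: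
  fixes f :: "'z \<Rightarrow> 'e" and H :: "'z \<times> real \<Rightarrow> 'b"
  assumes f: "continuous_map Z E f" and H: "continuous_map (prod_topology Z unit_interval) B H"
  obtains Z' :: "('e \<times> (real \<Rightarrow> 'b)) topology" and g where
    "quotient_map Z Z' g" "topspace Z' = g ` topspace Z"
    "continuous_map Z' E fst"
    "continuous_map (prod_topology Z' unit_interval) B (\<lambda>(z, t). snd z t)"
    "\<And>z. fst (g z) = f z" "\<And>z t. snd (g z) t = H (z, t)"
proof -
  define g where "g = (\<lambda>z. (f z, \<lambda>t. H (z, t)))"
  obtain Z' where q: "quotient_map Z Z' g" and top: "topspace Z' = g ` topspace Z"
    using ex_quotient_topology by blast
  have "continuous_map Z E (fst \<circ> g)" using f by (simp add: g_def o_def)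
  then have 1: "continuous_map Z' E fst" using continuous_compose_quotient_map[OF q] by blast
  have "locally_compact_space unit_interval"
    by (intro compact_imp_locally_compact_space) (simp add: compact_space_subtopology)
  moreover have "Hausdorff_space unit_interval"
    by (simp add: Hausdorff_space_subtopology)
  ultimately have qq: "quotient_map (prod_topology Z unit_interval) (prod_topology Z' unit_interval)
      (\<lambda>(x, y). (g x, y))"
    using quotient_map_prod_left q by blast
  have "(\<lambda>(z, t). snd z t) \<circ> (\<lambda>(x, y). (g x, y)) = H" by (auto simp: g_def)
  then have 2: "continuous_map (prod_topology Z' unit_interval) B (\<lambda>(z, t). snd z t)"
    using continuous_compose_quotient_map[OF qq] H by metis
  show ?thesis using that[OF q top 1 2] by (simp add: g_def)
qed

lemma hurewicz_fibrationD:
  fixes Z :: "'z topology"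
  assumes "hurewicz_fibration E B p"
  shows "homotopy_lifting_wrt Z E B p"
  unfolding homotopy_lifting_wrt_def
proof (intro allI impI, elim conjE)
  fix f H
  assume f: "continuous_map Z E f" and H: "continuous_map (prod_topology Z unit_interval) B H"
    and start: "\<forall>z\<in>topspace Z. H (z, 0) = p (f z)"
  obtain Z' g where *: "quotient_map Z Z' g" "topspace Z' = g ` topspace Z"
    "continuous_map Z' E fst"
    "continuous_map (prod_topology Z' unit_interval) B (\<lambda>(z, t). snd z t)"
    "\<And>z. fst (g z) = f z" "\<And>z t. snd (g z) t = H (z, t)"
    using factor_lifting_problem[OF f H] by blast
  have "homotopy_lifting_wrt Z' E B p" using assms by (simp add: hurewicz_fibration_def)
  moreover have "\<forall>z\<in>topspace Z'. (\<lambda>(z, t). snd z t) (z, 0) = p (fst z)"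
    using start * by simp
  ultimately obtain G where G: "continuous_map (prod_topology Z' unit_interval) E G"
    "\<forall>z\<in>topspace Z'. G (z, 0) = fst z"
    "\<forall>z\<in>topspace Z'. \<forall>s\<in>{0..1}. p (G (z, s)) = snd z s"
    using *(3,4) unfolding homotopy_lifting_wrt_def by force
  have g: "continuous_map Z Z' g" using *(1) quotient_imp_continuous_map by blast
  have "continuous_map (prod_topology Z unit_interval) (prod_topology Z' unit_interval)
      (\<lambda>(x, y). (g x, id y))"
    unfolding continuous_map_prod_top using g continuous_map_id by blast
  from continuous_map_compose[OF this G(1)]
  have "continuous_map (prod_topology Z unit_interval) E (\<lambda>(z, s). G (g z, s))"
    by (simp add: o_def case_prod_unfold)
  then show "\<exists>G. continuous_map (prod_topology Z unit_interval) E G \<and>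
      (\<forall>z\<in>topspace Z. G (z, 0) = f z) \<and>
      (\<forall>z\<in>topspace Z. \<forall>s\<in>{0..1}. p (G (z, s)) = H (z, s))"
    using G(2,3) * by (intro exI[of _ "\<lambda>(z, s). G (g z, s)"]) simp
qed

lemma msaf_lifting:
  fixes Z :: "'z topology"
  assumes "msaf A FA B FB q"
  shows "stratified_approximate_lifting_wrt Z A FA B FB q"
  unfolding stratified_approximate_lifting_wrt_def
proof (intro allI impI, elim conjE)
  fix f H
  assume f: "continuous_map Z A f" and H: "stratum_preserving_homotopy Z B FB H"
    and start: "\<forall>z\<in>topspace Z. H (z, 0) = q (f z)"
  have H1: "continuous_map (prod_topology Z unit_interval) B H"
    and H2: "\<And>z. z \<in> topspace Z \<Longrightarrow> \<exists>i. H ` ({z} \<times> {0..1}) \<subseteq> stratum FB i"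
    using H by (auto simp: stratum_preserving_homotopy_def stratum_preserving_along_def)
  obtain Z' g where *: "quotient_map Z Z' g" "topspace Z' = g ` topspace Z"
    "continuous_map Z' A fst"
    "continuous_map (prod_topology Z' unit_interval) B (\<lambda>(z, t). snd z t)"
    "\<And>z. fst (g z) = f z" "\<And>z t. snd (g z) t = H (z, t)"
    using factor_lifting_problem[OF f H1] by blast
  have "stratum_preserving_along (topspace Z') {0..1} FB (\<lambda>(z, t). snd z t)"
    unfolding stratum_preserving_along_def
  proof
    fix z' assume "z' \<in> topspace Z'"
    then obtain z where z: "z \<in> topspace Z" "z' = g z" using *(2) by blast
    then obtain i where "H ` ({z} \<times> {0..1}) \<subseteq> stratum FB i" using H2 by blast
    then show "\<exists>i. (\<lambda>(z, t). snd z t) ` ({z'} \<times> {0..1}) \<subseteq> stratum FB i"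
      using z *(6) by (intro exI[of _ i]) auto
  qed
  then have "stratum_preserving_homotopy Z' B FB (\<lambda>(z, t). snd z t)"
    using *(4) by (simp add: stratum_preserving_homotopy_def)
  moreover have lift: "stratified_approximate_lifting_wrt Z' A FA B FB q"
    using assms by (simp add: msaf_def)
  moreover have "\<forall>z\<in>topspace Z'. (\<lambda>(z, t). snd z t) (z, 0) = q (fst z)"
    using start * by simp
  ultimately obtain G where
    G: "continuous_map (prod_topology Z' (prod_topology unit_interval (top_of_set {0..<1}))) A G"
      "stratum_preserving_along (topspace Z') ({0..1} \<times> {0..<1}) FA G"
      "\<forall>z\<in>topspace Z'. \<forall>t\<in>{0..<1}. G (z, 0, t) = fst z"
      "continuous_map (prod_topology Z' (prod_topology unit_interval unit_interval)) B
         (\<lambda>(z, s, t). if t < 1 then q (G (z, s, t)) else (\<lambda>(z, t). snd z t) (z, s))"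
    using *(3) lift[unfolded stratified_approximate_lifting_wrt_def, THEN spec, THEN spec, THEN mp,
        of fst "\<lambda>(z, t). snd z t"] by blast
  have g: "continuous_map Z Z' g" using *(1) quotient_imp_continuous_map by blast
  have gT: "continuous_map (prod_topology Z T) (prod_topology Z' T) (\<lambda>(x, y). (g x, id y))"
    for T :: "(real \<times> real) topology"
    unfolding continuous_map_prod_top using g continuous_map_id by blast
  show "\<exists>G. continuous_map (prod_topology Z (prod_topology unit_interval (top_of_set {0..<1}))) A G \<and>
      stratum_preserving_along (topspace Z) ({0..1} \<times> {0..<1}) FA G \<and>
      (\<forall>z\<in>topspace Z. \<forall>t\<in>{0..<1}. G (z, 0, t) = f z) \<and>
      continuous_map (prod_topology Z (prod_topology unit_interval unit_interval)) B
        (\<lambda>(z, s, t). if t < 1 then q (G (z, s, t)) else H (z, s))"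
  proof (intro exI[of _ "\<lambda>(z, st). G (g z, st)"] conjI)
    show "continuous_map (prod_topology Z (prod_topology unit_interval (top_of_set {0..<1}))) A
        (\<lambda>(z, st). G (g z, st))"
      using continuous_map_compose[OF gT[of "prod_topology unit_interval (top_of_set {0..<1})"] G(1)]
      by (simp add: o_def case_prod_unfold)
    show "stratum_preserving_along (topspace Z) ({0..1} \<times> {0..<1}) FA (\<lambda>(z, st). G (g z, st))"
      unfolding stratum_preserving_along_def
    proof
      fix z assume "z \<in> topspace Z"
      then have "g z \<in> topspace Z'" using *(2) by blast
      then obtain i where "G ` ({g z} \<times> ({0..1} \<times> {0..<1})) \<subseteq> stratum FA i"
        using G(2) unfolding stratum_preserving_along_def by blast
      then show "\<exists>i. (\<lambda>(z, st). G (g z, st)) ` ({z} \<times> ({0..1} \<times> {0..<1})) \<subseteq> stratum FA i"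
        by (intro exI[of _ i]) auto
    qed
    show "\<forall>z\<in>topspace Z. \<forall>t\<in>{0..<1}. (\<lambda>(z, st). G (g z, st)) (z, 0, t) = f z"
      using G(3) * by simp
    have eq: "(\<lambda>(z, s, t). if t < 1 then q (G (z, s, t)) else (\<lambda>(z, t). snd z t) (z, s)) \<circ>
        (\<lambda>(x, y). (g x, id y)) =
        (\<lambda>(z, s, t). if t < 1 then q ((\<lambda>(z, st). G (g z, st)) (z, s, t)) else H (z, s))"
      using *(6) by (auto simp: fun_eq_iff)
    show "continuous_map (prod_topology Z (prod_topology unit_interval unit_interval)) B
        (\<lambda>(z, s, t). if t < 1 then q ((\<lambda>(z, st). G (g z, st)) (z, s, t)) else H (z, s))"
      unfolding eq[symmetric] by (rule continuous_map_compose[OF gT G(4)])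
  qed
qed

end

theory Submission
  imports Defs
begin

text \<open>Let \<open>p : N - Y \<rightarrow> Y \<times> \<real>\<close> be the manifold stratified approximate fibration whose teardrop is
  \<open>N\<close>. Points of \<open>N - Y\<close> whose height, the real coordinate of \<open>p\<close>, is large are close to \<open>Y\<close>, so
  pushing outward means letting the height tend to \<open>-\<infinity>\<close>. Translation of \<open>Y \<times> \<real>\<close> downward along the
  line preserves strata, and it lifts approximately to a stratum-preserving homotopy of
  \<open>f : Z \<rightarrow> N - Y\<close>, with an error of at most \<open>1\<close> in the height; this is \<open>msaf_outward_push\<close>.

  Properness of the lifted homotopy rests on two facts. First, the collapse
  \<open>N \<rightarrow> Y \<times> (-\<infinity>, \<infinity>]\<close> is proper and continuous: a compact subset of \<open>N\<close> has height bounded below and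
  lies over a compact subset of \<open>Y\<close> (\<open>teardrop_compact_bounds\<close>), and conversely the set of points of
  height at least \<open>a\<close> over a compact subset of \<open>Y\<close>, together with that subset, is compact
  (\<open>compactin_teardrop_tail\<close>). Secondly, the error of the lift in the direction of \<open>Y\<close> is controlled by
  an exhausting function \<open>\<phi>\<close> on \<open>Y\<close> (\<open>exhausting_function_exists\<close>), whose value drops by at most
  \<open>1\<close> along the lift. So if the track of \<open>z\<close> meets a compact set \<open>K\<close> at time \<open>T\<close>, then \<open>f z\<close> lies in a compact set
  that depends only on \<open>K\<close>. As \<open>f\<close> is proper, \<open>z\<close> lies in a compact set too; the height of \<open>f z\<close> is
  bounded there, and this bounds the time before the track has sunk below \<open>K\<close>.\<close>

section \<open>Two constructions of real functions\<close>

text \<open>Sum countably many bump functions with compact supports, the \<open>n\<close>-th one weighted by \<open>(1/2)^n\<close>: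
  the total \<open>\<psi>\<close> is positive because the bumps cover, and it can exceed a given positive number only on
  the union of finitely many supports, since the tail of the series is uniformly small. The reciprocal
  of \<open>\<psi>\<close> therefore exhausts the space. Its role is to measure how far points move in \<open>Y\<close>: motions
  that change it by a bounded amount cannot bring points from infinity back into a compact set.\<close>

lemma exhausting_function_exists:
  assumes "locally_compact_space Y" "completely_regular_space Y" "Lindelof_space Y"
  obtains \<phi> where "continuous_map Y euclideanreal \<phi>"
    and "\<And>b. compactin Y {y \<in> topspace Y. \<phi> y \<le> b}"
proof (cases "topspace Y = {}")
  case True
  then show ?thesis
    using that[of "\<lambda>_. 0"] by (simp add: compactin_empty)
next
  case False
  have "\<exists>u K. continuous_map Y euclideanreal u \<and> (\<forall>y\<in>topspace Y. 0 \<le> u y \<and> u y \<le> 1) \<and>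
      0 < u x \<and> compactin Y K \<and> (\<forall>y\<in>topspace Y - K. u y = 0)" if x: "x \<in> topspace Y" for x
  proof -
    obtain U K where U: "openin Y U" "compactin Y K" "x \<in> U" "U \<subseteq> K"
      using assms(1) x unfolding locally_compact_space_def by blast
    then have "closedin Y (topspace Y - U)" "x \<in> topspace Y - (topspace Y - U)"
      using x by auto
    then obtain f :: "'a \<Rightarrow> real" where f: "continuous_map Y (top_of_set {0..1}) f" "f x = 0"
      "f ` (topspace Y - U) \<subseteq> {1}"
      using assms(2) unfolding completely_regular_space_def by meson
    have fc: "continuous_map Y euclideanreal f" and fb: "\<forall>y\<in>topspace Y. f y \<in> {0..1}"
      using f(1) by (auto simp: continuous_map_in_subtopology)
    have "continuous_map Y euclideanreal (\<lambda>y. 1 - f y)"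
      by (intro continuous_intros fc)
    then show ?thesis
      using fb f U(2,4) by (intro exI[of _ "\<lambda>y. 1 - f y"] exI[of _ K]) auto
  qed
  then have "\<forall>x\<in>topspace Y. \<exists>uK. continuous_map Y euclideanreal (fst uK) \<and>
      (\<forall>y\<in>topspace Y. 0 \<le> fst uK y \<and> fst uK y \<le> 1) \<and>
      0 < fst uK x \<and> compactin Y (snd uK) \<and> (\<forall>y\<in>topspace Y - snd uK. fst uK y = 0)"
    by simp
  from bchoice[OF this] obtain uK where uK': "\<forall>x\<in>topspace Y. continuous_map Y euclideanreal (fst (uK x)) \<and>
      (\<forall>y\<in>topspace Y. 0 \<le> fst (uK x) y \<and> fst (uK x) y \<le> 1) \<and>
      0 < fst (uK x) x \<and> compactin Y (snd (uK x)) \<and> (\<forall>y\<in>topspace Y - snd (uK x). fst (uK x) y = 0)"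
    by blast
  define u K where "u = (\<lambda>x. fst (uK x))" and "K = (\<lambda>x. snd (uK x))"
  have u: "\<And>x. x \<in> topspace Y \<Longrightarrow> continuous_map Y euclideanreal (u x)"
    and u01: "\<And>x y. x \<in> topspace Y \<Longrightarrow> y \<in> topspace Y \<Longrightarrow> 0 \<le> u x y \<and> u x y \<le> 1"
    and upos: "\<And>x. x \<in> topspace Y \<Longrightarrow> 0 < u x x"
    and K: "\<And>x. x \<in> topspace Y \<Longrightarrow> compactin Y (K x)"
    and uK: "\<And>x y. x \<in> topspace Y \<Longrightarrow> y \<in> topspace Y - K x \<Longrightarrow> u x y = 0"
    using uK' by (simp_all add: u_def K_def)
  define P where "P = (\<lambda>x. {y \<in> topspace Y. u x y \<in> {0<..}})"
  have Pop: "openin Y (P x)" if "x \<in> topspace Y" for x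
    unfolding P_def by (rule openin_continuous_map_preimage[OF u[OF that]]) simp
  have UP: "\<Union>(P ` topspace Y) = topspace Y" unfolding P_def using upos by auto
  have "\<exists>\<V>. countable \<V> \<and> \<V> \<subseteq> P ` topspace Y \<and> \<Union>\<V> = topspace Y"
    by (rule Lindelof_spaceD[OF assms(3) _ UP]) (use Pop in auto)
  then obtain \<V> where \<V>: "countable \<V>" "\<V> \<subseteq> P ` topspace Y" "\<Union>\<V> = topspace Y"
    by (elim exE conjE) (rule that)
  then obtain A where A: "countable A" "A \<subseteq> topspace Y" "\<V> = P ` A"
    by (meson countable_subset_image)
  have "A \<noteq> {}" using False by (metis A(3) \<V>(3) Sup_empty image_empty)
  define a where "a = from_nat_into A"
  have aY: "a n \<in> topspace Y" for n
    unfolding a_def using from_nat_into[OF \<open>A \<noteq> {}\<close>] A(2) by blast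
  have cover: "\<exists>n. 0 < u (a n) y" if "y \<in> topspace Y" for y
  proof -
    have "y \<in> \<Union>(P ` A)" using that \<V>(3) A(3) by metis
    then obtain x where "x \<in> A" "y \<in> P x" by (elim UN_E)
    then show ?thesis
      using from_nat_into_surj[OF A(1)] unfolding P_def a_def
      by (metis (mono_tags, lifting) greaterThan_iff mem_Collect_eq)
  qed
  define \<psi> where "\<psi> = (\<lambda>y. \<Sum>n. (1/2)^n * u (a n) y)"
  have summand: "0 \<le> (1/2)^n * u (a n) y" "(1/2)^n * u (a n) y \<le> (1/2)^n" if "y \<in> topspace Y" for n y
    using u01[OF aY that, of n] by (auto simp: mult_left_le)
  have geo: "summable (\<lambda>n. (1/2::real)^n)" by (simp add: summable_geometric)
  have summ: "summable (\<lambda>n. (1/2)^n * u (a n) y)" if "y \<in> topspace Y" for y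
    by (rule summable_comparison_test'[OF geo, of 0]) (use summand[OF that] in auto)
  have tail: "\<psi> y - (\<Sum>n<m. (1/2)^n * u (a n) y) \<in> {0..2 * (1/2)^m}" if "y \<in> topspace Y" for m y
  proof -
    have s: "summable (\<lambda>n. (1/2)^(n+m) * u (a (n+m)) y)"
      using summ[OF that] by (rule summable_ignore_initial_segment)
    have e: "\<psi> y - (\<Sum>n<m. (1/2)^n * u (a n) y) = (\<Sum>n. (1/2)^(n+m) * u (a (n+m)) y)"
      unfolding \<psi>_def using suminf_split_initial_segment[OF summ[OF that], of m] by simp
    have "(\<Sum>n. (1/2)^(n+m) * u (a (n+m)) y) \<le> (\<Sum>n. (1/2::real)^(n+m))"
      by (rule suminf_le[OF summand(2)[OF that] s]) (use geo in \<open>rule summable_ignore_initial_segment\<close>)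
    also have "\<dots> = 2 * (1/2)^m"
      by (simp add: power_add suminf_mult2[symmetric] suminf_geometric summable_geometric)
    finally show ?thesis
      unfolding e using suminf_nonneg[OF s] summand(1)[OF that] by auto
  qed
  have \<psi>cont: "continuous_map Y euclideanreal \<psi>"
  proof -
    have partial: "continuous_map Y euclideanreal (\<lambda>y. \<Sum>n<m. (1/2)^n * u (a n) y)" for m
      by (intro continuous_map_sum continuous_map_real_mult_left u aY) simp
    have "continuous_map Y Met_TC.mtopology \<psi>"
    proof (rule Met_TC.continuous_map_uniform_limit[where F = sequentially
          and f = "\<lambda>m y. \<Sum>n<m. (1/2)^n * u (a n) y"])
      show "\<forall>\<^sub>F m in sequentially. continuous_map Y Met_TC.mtopology (\<lambda>y. \<Sum>n<m. (1/2)^n * u (a n) y)"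
        using partial by simp
      fix \<epsilon> :: real assume "\<epsilon> > 0"
      have "(\<lambda>m. 2 * (1/2::real)^m) \<longlonglongrightarrow> 2 * 0"
        by (intro tendsto_mult tendsto_const LIMSEQ_power_zero) simp
      then have "\<forall>\<^sub>F m in sequentially. 2 * (1/2::real)^m < \<epsilon>"
        using \<open>\<epsilon> > 0\<close> by (metis mult_zero_right order_tendstoD(2))
      then show "\<forall>\<^sub>F m in sequentially. \<forall>y\<in>topspace Y. \<psi> y \<in> UNIV \<and>
          dist (\<Sum>n<m. (1/2)^n * u (a n) y) (\<psi> y) < \<epsilon>"
      proof eventually_elim
        case (elim m)
        show ?case
        proof
          fix y assume "y \<in> topspace Y"
          from tail[OF this, of m] elim
          show "\<psi> y \<in> UNIV \<and> dist (\<Sum>n<m. (1/2)^n * u (a n) y) (\<psi> y) < \<epsilon>"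
            by (auto simp: dist_real_def)
        qed
      qed
    qed simp
    then show ?thesis by simp
  qed
  have \<psi>pos: "\<psi> y > 0" if "y \<in> topspace Y" for y
  proof -
    from cover[OF that] obtain n where "0 < u (a n) y" by (elim exE)
    then have "0 < (1/2)^n * u (a n) y" by simp
    then show ?thesis
      unfolding \<psi>_def using suminf_pos_iff[OF summ[OF that] summand(1)[OF that]] by metis
  qed
  have \<phi>cont: "continuous_map Y euclideanreal (\<lambda>y. inverse (\<psi> y))"
    by (rule continuous_map_real_inverse[OF \<psi>cont]) (use \<psi>pos in force)
  show ?thesis
  proof (rule that[OF \<phi>cont])
    fix b
    obtain m where m: "2 * (1/2::real)^m < inverse (max b 1)"
    proof -
      have "0 < inverse (max b 1) / 2" by simp
      then obtain m where "(1/2::real)^m < inverse (max b 1) / 2"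
        using real_arch_pow_inv[of "inverse (max b 1) / 2" "1/2"] by auto
      then have "2 * (1/2::real)^m < inverse (max b 1)" by linarith
      then show ?thesis by (rule that)
    qed
    have "{y \<in> topspace Y. inverse (\<psi> y) \<le> b} \<subseteq> (\<Union>n<m. K (a n))"
    proof clarify
      fix y assume y: "y \<in> topspace Y" "inverse (\<psi> y) \<le> b"
      have "inverse (\<psi> y) \<le> max b 1" using y by simp
      then have "inverse (max b 1) \<le> \<psi> y"
        using \<psi>pos[OF y(1)] by (metis inverse_inverse_eq inverse_positive_iff_positive le_imp_inverse_le)
      with m tail[OF y(1), of m] have "(\<Sum>n<m. (1/2)^n * u (a n) y) \<noteq> 0" by auto
      then obtain n where "n < m" "u (a n) y \<noteq> 0"
        by (metis (no_types, lifting) lessThan_iff mult_zero_right sum.neutral)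
      then show "y \<in> (\<Union>n<m. K (a n))" using uK[OF aY] y(1) by blast
    qed
    moreover have "compactin Y (\<Union>n<m. K (a n))"
      by (rule compactin_Union) (use K aY in auto)
    moreover have "closedin Y {y \<in> topspace Y. inverse (\<psi> y) \<in> {..b}}"
      by (rule closedin_continuous_map_preimage[OF \<phi>cont]) simp
    ultimately show "compactin Y {y \<in> topspace Y. inverse (\<psi> y) \<le> b}"
      by (simp add: closed_compactin)
  qed
qed

text \<open>An approximate lift has an error \<open>e\<close> that vanishes at time \<open>1\<close>. Over a noncompact parameter
  space no single time makes it small, and taking the last time at which it is large need not be
  continuous. The maximum over \<open>t\<close> of \<open>t\<close> times the error truncated to the unit interval is
  continuous, because the unit interval is compact; it is at least every time at which the error is
  \<open>1\<close> or more, and it does not reach \<open>1\<close>, since a factor \<open>1\<close> in front forces the other one to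
  vanish.\<close>

lemma continuous_small_error_selection:
  fixes e :: "'w \<times> real \<Rightarrow> real"
  assumes e: "continuous_map (prod_topology W unit_interval) euclideanreal e"
    and e1: "\<And>w. w \<in> topspace W \<Longrightarrow> e (w, 1) = 0"
  obtains \<delta> where "continuous_map W (top_of_set {0..<1}) \<delta>"
    and "\<And>w. w \<in> topspace W \<Longrightarrow> e (w, \<delta> w) \<le> 1"
proof -
  define g where "g = (\<lambda>(w, t). t * max 0 (min 1 (e (w, t))))"
  have g: "continuous_map (prod_topology W unit_interval) euclideanreal g"
  proof -
    have "continuous_map (prod_topology W unit_interval) euclideanreal snd"
      by (metis continuous_map_into_fulltopology continuous_map_snd)
    then have "continuous_map (prod_topology W unit_interval) euclideanreal
        (\<lambda>x. snd x * max 0 (min 1 (e x)))"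
      by (intro continuous_intros e)
    then show ?thesis by (simp add: g_def case_prod_unfold)
  qed
  define \<delta> where "\<delta> = (\<lambda>w. SUP t\<in>{0..1}. g (w, t))"
  have attained: "\<exists>t\<in>{0..1}. \<delta> w = g (w, t) \<and> (\<forall>t'\<in>{0..1}. g (w, t') \<le> g (w, t))" if w: "w \<in> topspace W" for w
  proof -
    have "continuous_map unit_interval (prod_topology W unit_interval) (\<lambda>t. (w, t))"
      using w by (intro continuous_map_pairedI) auto
    from continuous_map_compose[OF this g] have "continuous_on {0..1} (\<lambda>t. g (w, t))"
      by (simp add: o_def)
    then obtain t where "t \<in> {0..1}" "\<forall>t'\<in>{0..1}. g (w, t') \<le> g (w, t)"
      using continuous_attains_sup[of "{0..1::real}" "\<lambda>t. g (w, t)"] by auto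
    moreover from this have "\<delta> w = g (w, t)"
      unfolding \<delta>_def by (intro cSup_eq_maximum) auto
    ultimately show ?thesis by blast
  qed
  have ub: "g (w, t) \<le> \<delta> w" if "w \<in> topspace W" "t \<in> {0..1}" for w t
    using attained[OF that(1)] that(2) by auto
  have range: "\<delta> w \<in> {0..<1}" if w: "w \<in> topspace W" for w
  proof -
    obtain t where t: "t \<in> {0..1}" "\<delta> w = g (w, t)" using attained[OF w] by blast
    have "t * max 0 (min 1 (e (w, t))) < 1"
    proof (cases "t = 1")
      case True then show ?thesis using e1[OF w] by simp
    next
      case False
      have "t * max 0 (min 1 (e (w, t))) \<le> t * 1" using t by (intro mult_left_mono) auto
      then show ?thesis using False t by auto
    qed
    moreover have "0 \<le> t * max 0 (min 1 (e (w, t)))" using t by simp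
    ultimately show ?thesis using t by (simp add: g_def)
  qed
  \<comment> \<open>Both semicontinuities come from the projection to \<open>W\<close>: it is open, and it is closed because
    its fibres are copies of a fixed compact space.\<close>
  have "openin W {w \<in> topspace W. a < \<delta> w}" for a
  proof -
    have "openin (prod_topology W unit_interval) {x \<in> topspace (prod_topology W unit_interval). g x \<in> {a<..}}"
      by (rule openin_continuous_map_preimage[OF g]) simp
    then have "openin W (fst ` {x \<in> topspace (prod_topology W unit_interval). g x \<in> {a<..}})"
      using open_map_fst unfolding open_map_def by blast
    moreover have "fst ` {x \<in> topspace (prod_topology W unit_interval). g x \<in> {a<..}} = {w \<in> topspace W. a < \<delta> w}"
    proof (intro equalityI subsetI)
      fix w assume "w \<in> {w \<in> topspace W. a < \<delta> w}"
      then show "w \<in> fst ` {x \<in> topspace (prod_topology W unit_interval). g x \<in> {a<..}}"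
        using attained[of w] by force
    qed (use ub in \<open>force intro: less_le_trans\<close>)
    ultimately show ?thesis by simp
  qed
  moreover have "closedin W {w \<in> topspace W. a \<le> \<delta> w}" for a
  proof -
    have "closedin (prod_topology W unit_interval) {x \<in> topspace (prod_topology W unit_interval). g x \<in> {a..}}"
      by (rule closedin_continuous_map_preimage[OF g]) simp
    moreover have "compact_space unit_interval" by (simp add: compact_space_subtopology)
    ultimately have "closedin W (fst ` {x \<in> topspace (prod_topology W unit_interval). g x \<in> {a..}})"
      using closed_map_fst unfolding closed_map_def by blast
    moreover have "fst ` {x \<in> topspace (prod_topology W unit_interval). g x \<in> {a..}} = {w \<in> topspace W. a \<le> \<delta> w}"
    proof (intro equalityI subsetI)
      fix w assume "w \<in> {w \<in> topspace W. a \<le> \<delta> w}"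
      then show "w \<in> fst ` {x \<in> topspace (prod_topology W unit_interval). g x \<in> {a..}}"
        using attained[of w] by force
    qed (use ub in \<open>force intro: order_trans\<close>)
    ultimately show ?thesis by simp
  qed
  then have "openin W {w \<in> topspace W. \<delta> w < a}" for a
  proof -
    have "topspace W - {w \<in> topspace W. a \<le> \<delta> w} = {w \<in> topspace W. \<delta> w < a}" by auto
    then show ?thesis using \<open>closedin W {w \<in> topspace W. a \<le> \<delta> w}\<close> by (metis closedin_def)
  qed
  ultimately have cont: "continuous_map W (top_of_set {0..<1}) \<delta>"
    using range unfolding continuous_map_upper_lower_semicontinuous_lt_gen by blast
  have "e (w, \<delta> w) \<le> 1" if w: "w \<in> topspace W" for w
  proof (rule ccontr)
    assume "\<not> e (w, \<delta> w) \<le> 1"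
    have "continuous_map unit_interval (prod_topology W unit_interval) (\<lambda>t. (w, t))"
      using w by (intro continuous_map_pairedI) auto
    from continuous_map_compose[OF this e] have "continuous_on {0..1} (\<lambda>t. e (w, t))"
      by (simp add: o_def)
    then have "((\<lambda>t. e (w, t)) \<longlongrightarrow> e (w, \<delta> w)) (at (\<delta> w) within {0..1})"
      using range[OF w] by (auto simp: continuous_on)
    then have "\<forall>\<^sub>F t in at (\<delta> w) within {0..1}. 1 < e (w, t)"
      using \<open>\<not> e (w, \<delta> w) \<le> 1\<close> by (intro order_tendstoD) auto
    then obtain d where d: "d > 0" "\<And>t. t \<in> {0..1} \<Longrightarrow> t \<noteq> \<delta> w \<Longrightarrow> dist t (\<delta> w) < d \<Longrightarrow> 1 < e (w, t)"
      unfolding eventually_at by blast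
    \<comment> \<open>The error would still exceed 1 at a time beyond the maximum.\<close>
    define t where "t = min 1 (\<delta> w + d/2)"
    have t: "t \<in> {0..1}" "\<delta> w < t" "dist t (\<delta> w) < d"
      using range[OF w] d(1) by (auto simp: t_def dist_real_def)
    then have "g (w, t) = t" using d(2)[of t] by (simp add: g_def)
    then show False using ub[OF w t(1)] t(2) by simp
  qed
  with cont show ?thesis using that by blast
qed

section \<open>Compact sets in teardrops\<close>

text \<open>The subbasic open sets that contain points of the end \<open>Y\<close> are pulled back from
  \<open>Y \<times> (-\<infinity>, \<infinity>]\<close>, so a neighborhood of a point at the end contains everything that lies over a
  neighborhood of the point and sufficiently high.\<close>

lemma teardrop_neighborhood_of_end:
  assumes "continuous_map W (prod_topology Y euclideanreal) p"
    and "openin (teardrop W Y p) U" and "Inr y \<in> U"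
  shows "\<exists>A R. openin Y A \<and> y \<in> A \<and> Inr ` A \<subseteq> U \<and>
           (\<forall>w\<in>topspace W. fst (p w) \<in> A \<and> R < snd (p w) \<longrightarrow> Inl w \<in> U)"
proof -
  let ?B = "{Inl ` U | U. openin W U} \<union>
      {{x \<in> topspace W <+> topspace Y. teardrop_collapse p x \<in> V} | V.
         openin (prod_topology Y (top_of_set {-\<infinity><..})) V}"
  have "generate_topology_on ?B U"
    using assms(2) unfolding teardrop_def by (rule openin_topology_generated_by)
  then show ?thesis using assms(3)
  proof (induction)
    case Empty
    then show ?case by simp
  next
    case (Int a b)
    then have ab: "Inr y \<in> a" "Inr y \<in> b" by simp_all
    from Int.IH(1)[OF ab(1)] obtain A R where "openin Y A \<and> y \<in> A \<and> Inr ` A \<subseteq> a \<and>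
        (\<forall>w\<in>topspace W. fst (p w) \<in> A \<and> R < snd (p w) \<longrightarrow> Inl w \<in> a)"
      by (elim exE) (rule that)
    moreover from Int.IH(2)[OF ab(2)] obtain A' R' where "openin Y A' \<and> y \<in> A' \<and> Inr ` A' \<subseteq> b \<and>
        (\<forall>w\<in>topspace W. fst (p w) \<in> A' \<and> R' < snd (p w) \<longrightarrow> Inl w \<in> b)"
      by (elim exE) (rule that)
    ultimately show ?case by (intro exI[of _ "A \<inter> A'"] exI[of _ "max R R'"]) auto
  next
    case (UN K)
    then obtain k where k: "k \<in> K" "Inr y \<in> k" by blast
    from UN.IH[OF this] obtain A R where "openin Y A \<and> y \<in> A \<and> Inr ` A \<subseteq> k \<and>
           (\<forall>w\<in>topspace W. fst (p w) \<in> A \<and> R < snd (p w) \<longrightarrow> Inl w \<in> k)" by blast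
    then show ?case using k(1) by (intro exI[of _ A] exI[of _ R]) blast
  next
    case (Basis s)
    then obtain V where V: "s = {x \<in> topspace W <+> topspace Y. teardrop_collapse p x \<in> V}"
      "openin (prod_topology Y (top_of_set {-\<infinity><..})) V" by blast
    then have "(y, \<infinity>) \<in> V" using Basis.prems by (simp add: teardrop_collapse_def)
    then obtain A E where A: "openin Y A" "y \<in> A" and E: "openin (top_of_set {-\<infinity><..}) E" "\<infinity> \<in> E"
      and AE: "A \<times> E \<subseteq> V"
      using V(2) unfolding openin_prod_topology_alt by blast
    have "open E" using E(1) by (simp add: openin_open_eq)
    then obtain R where R: "{ereal R<..} \<subseteq> E"
      using E(2) open_PInfty by blast
    show ?case
    proof (intro exI[of _ A] exI[of _ R] conjI ballI impI)
      have "A \<subseteq> topspace Y" using A(1) by (rule openin_subset)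
      then show "Inr ` A \<subseteq> s" using AE E(2) unfolding V(1) by (auto simp: teardrop_collapse_def)
      fix w assume "w \<in> topspace W" "fst (p w) \<in> A \<and> R < snd (p w)"
      moreover from this have "(fst (p w), ereal (snd (p w))) \<in> A \<times> E" using R by auto
      ultimately show "Inl w \<in> s" using AE unfolding V(1) by (auto simp: teardrop_collapse_def)
    qed (use A in auto)
  qed
qed

text \<open>The collapse of the teardrop of a proper map is proper: finitely many neighborhoods of points of
  \<open>C\<close> contain everything over \<open>C\<close> above some height \<open>r\<close>, and what remains is the preimage of the
  compact set \<open>C \<times> {a..r}\<close> under \<open>p\<close>.\<close>

lemma compactin_teardrop_tail:
  assumes p: "compact_preimage_map W (prod_topology Y euclideanreal) p" and C: "compactin Y C"
  shows "compactin (teardrop W Y p) (Inl ` {w \<in> topspace W. fst (p w) \<in> C \<and> a \<le> snd (p w)} \<union> Inr ` C)"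
    (is "compactin ?T ?L")
  unfolding compactin_def
proof (intro conjI allI impI)
  have pc: "continuous_map W (prod_topology Y euclideanreal) p"
    using p by (simp add: compact_preimage_map_def)
  have CY: "C \<subseteq> topspace Y" using C by (rule compactin_subset_topspace)
  then show "?L \<subseteq> topspace ?T" unfolding topspace_teardrop[OF pc] by auto
  fix \<U> assume \<U>: "(\<forall>U\<in>\<U>. openin ?T U) \<and> ?L \<subseteq> \<Union>\<U>"
  then have \<U>op: "openin ?T U" if "U \<in> \<U>" for U using that by blast
  have "\<forall>y\<in>C. \<exists>U A R. U \<in> \<U> \<and> openin Y A \<and> y \<in> A \<and> Inr ` A \<subseteq> U \<and>
           (\<forall>w\<in>topspace W. fst (p w) \<in> A \<and> R < snd (p w) \<longrightarrow> Inl w \<in> U)"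
  proof
    fix y assume "y \<in> C"
    then obtain U where "U \<in> \<U>" "Inr y \<in> U" using \<U> by blast
    then show "\<exists>U A R. U \<in> \<U> \<and> openin Y A \<and> y \<in> A \<and> Inr ` A \<subseteq> U \<and>
           (\<forall>w\<in>topspace W. fst (p w) \<in> A \<and> R < snd (p w) \<longrightarrow> Inl w \<in> U)"
      using teardrop_neighborhood_of_end[OF pc, of U y] \<U> by blast
  qed
  then obtain U A R where UAR: "\<And>y. y \<in> C \<Longrightarrow> U y \<in> \<U> \<and> openin Y (A y) \<and> y \<in> A y \<and> Inr ` A y \<subseteq> U y \<and>
           (\<forall>w\<in>topspace W. fst (p w) \<in> A y \<and> R y < snd (p w) \<longrightarrow> Inl w \<in> U y)"
    by metis
  have "\<exists>\<F>. finite \<F> \<and> \<F> \<subseteq> A ` C \<and> C \<subseteq> \<Union>\<F>"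
    using UAR by (intro compactinD[OF C]) auto
  then obtain I where I: "finite I" "I \<subseteq> C" "C \<subseteq> \<Union>(A ` I)"
    by (metis finite_subset_image)
  define r where "r = Max (insert a (R ` I))"
  have r: "R i \<le> r" if "i \<in> I" for i unfolding r_def using I(1) that by auto
  have "compactin (prod_topology Y euclideanreal) (C \<times> {a..r})"
    using C by (simp add: compactin_Times)
  then have "compactin W {w \<in> topspace W. p w \<in> C \<times> {a..r}}"
    using p unfolding compact_preimage_map_def by blast
  moreover have "continuous_map W ?T Inl"
    using teardrop_properties(1)[OF pc] unfolding embedding_map_def
    by (blast dest: homeomorphic_imp_continuous_map continuous_map_into_fulltopology)
  ultimately have cM: "compactin ?T (Inl ` {w \<in> topspace W. p w \<in> C \<times> {a..r}})"
    by (rule image_compactin)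
  have "Inl ` {w \<in> topspace W. p w \<in> C \<times> {a..r}} \<subseteq> ?L" by auto
  then have "Inl ` {w \<in> topspace W. p w \<in> C \<times> {a..r}} \<subseteq> \<Union>\<U>"
    by (rule subset_trans[OF _ conjunct2[OF \<U>]])
  have "\<exists>\<F>. finite \<F> \<and> \<F> \<subseteq> \<U> \<and> Inl ` {w \<in> topspace W. p w \<in> C \<times> {a..r}} \<subseteq> \<Union>\<F>"
    by (rule compactinD[OF cM \<U>op \<open>_ \<subseteq> \<Union>\<U>\<close>])
  then obtain \<F> where \<F>: "finite \<F>" "\<F> \<subseteq> \<U>" "Inl ` {w \<in> topspace W. p w \<in> C \<times> {a..r}} \<subseteq> \<Union>\<F>"
    by (elim exE conjE) (rule that)
  have "?L \<subseteq> \<Union>(\<F> \<union> U ` I)"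
  proof
    fix x assume "x \<in> ?L"
    then consider (inl) w where "x = Inl w" "w \<in> topspace W" "fst (p w) \<in> C" "a \<le> snd (p w)"
      | (inr) y where "x = Inr y" "y \<in> C" by blast
    then show "x \<in> \<Union>(\<F> \<union> U ` I)"
    proof cases
      case inl
      show ?thesis
      proof (cases "snd (p w) \<le> r")
        case True
        then have "p w \<in> C \<times> {a..r}" using inl by (simp add: mem_Times_iff)
        then have "x \<in> Inl ` {w \<in> topspace W. p w \<in> C \<times> {a..r}}"
          unfolding inl(1) using inl(2) by (intro imageI CollectI conjI)
        then have "x \<in> \<Union>\<F>" by (rule subsetD[OF \<F>(3)])
        then show ?thesis by simp
      next
        case False
        obtain i where i: "i \<in> I" "fst (p w) \<in> A i" using I(3) inl(3) by blast
        then have "R i < snd (p w)" using r[OF i(1)] False by simp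
        then have "x \<in> U i" using UAR I(2) i inl by blast
        then show ?thesis using i by blast
      qed
    next
      case inr
      then obtain i where "i \<in> I" "y \<in> A i" using I(3) by blast
      then show ?thesis using UAR I(2) inr by blast
    qed
  qed
  moreover have "finite (\<F> \<union> U ` I)" "\<F> \<union> U ` I \<subseteq> \<U>"
    using \<F> I UAR by auto
  ultimately show "\<exists>\<F>. finite \<F> \<and> \<F> \<subseteq> \<U> \<and> ?L \<subseteq> \<Union>\<F>" by blast
qed

text \<open>This is the image of \<open>K\<close> under the collapse being compact, read off in the two coordinates. The
  height is bounded only from below, since compact sets may reach the end, where it is infinite.\<close>

lemma teardrop_compact_bounds:
  assumes p: "continuous_map W (prod_topology Y euclideanreal) p"
    and K: "compactin (teardrop W Y p) K" and \<phi>: "continuous_map Y euclideanreal \<phi>"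
  obtains a b where "\<And>w. Inl w \<in> K \<Longrightarrow> \<phi> (fst (p w)) \<le> b \<and> a \<le> snd (p w)"
proof -
  let ?c = "teardrop_collapse p"
  have c: "continuous_map (teardrop W Y p) (prod_topology Y (top_of_set {-\<infinity><..})) ?c"
    using teardrop_properties(3)[OF p] .
  have "continuous_map (teardrop W Y p) euclideanreal (\<phi> \<circ> (fst \<circ> ?c))"
    using continuous_map_compose[OF continuous_map_fst_of[OF c] \<phi>] .
  from image_compactin[OF K this] have "bounded ((\<phi> \<circ> (fst \<circ> ?c)) ` K)"
    by (simp add: compact_imp_bounded)
  then obtain b where "\<forall>x\<in>K. \<bar>\<phi> (fst (?c x))\<bar> \<le> b"
    unfolding bounded_real by auto
  then have b: "\<phi> (fst (?c x)) \<le> b" if "x \<in> K" for x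
    using that by (blast intro: order_trans[OF abs_ge_self])
  from image_compactin[OF K continuous_map_snd_of[OF c]]
  have cs: "compact ((snd \<circ> ?c) ` K)" "(snd \<circ> ?c) ` K \<subseteq> {-\<infinity><..}"
    by (auto simp: compactin_subtopology)
  have "\<exists>a::real. \<forall>x\<in>K. ereal a \<le> snd (?c x)"
  proof (cases "K = {}")
    case False
    then obtain m where m: "m \<in> (snd \<circ> ?c) ` K" "\<And>t. t \<in> (snd \<circ> ?c) ` K \<Longrightarrow> m \<le> t"
      using compact_attains_inf[OF cs(1)] by blast
    then have "-\<infinity> < m" using cs(2) by blast
    then obtain a where "ereal a \<le> m" by (metis ereal_dense2 less_imp_le)
    then have "ereal a \<le> snd (?c x)" if "x \<in> K" for x
      using m(2)[of "snd (?c x)"] that by (simp add: image_iff) (metis order_trans)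
    then show ?thesis by (intro exI[of _ a] ballI)
  qed simp
  then obtain a where a: "\<And>x. x \<in> K \<Longrightarrow> ereal a \<le> snd (?c x)" by blast
  show ?thesis
    by (rule that[of b a]) (use a b in \<open>fastforce simp: teardrop_collapse_def\<close>)
qed

section \<open>Strata\<close>

lemma stratum_exists:
  assumes "filtered_space X F" "x \<in> topspace X"
  shows "\<exists>i. x \<in> stratum F i"
proof -
  define i where "i = (LEAST i. x \<in> F i)"
  have ex: "\<exists>i. x \<in> F i" using assms unfolding filtered_space_def by metis
  then have "x \<in> F i" unfolding i_def by (rule LeastI_ex)
  moreover have "x \<notin> F j" if "j < i" for j using that unfolding i_def by (rule not_less_Least)
  ultimately show ?thesis by (intro exI[of _ i]) (auto simp: stratum_def split: nat.split)
qed

lemma stratum_unique: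
  assumes "filtered_space X F" "x \<in> stratum F i" "x \<in> stratum F j"
  shows "i = j"
proof -
  have mono: "F a \<subseteq> F b" if "a \<le> b" for a b
    by (rule lift_Suc_mono_le[OF _ that]) (use assms(1) in \<open>simp add: filtered_space_def\<close>)
  have "\<not> a < b" if "x \<in> stratum F a" "x \<in> stratum F b" for a b
    using that mono[of a "b - 1"] by (auto simp: stratum_def split: nat.splits)
  with assms(2,3) show ?thesis by (metis linorder_neqE_nat)
qed

text \<open>The strata are manifolds, hence second countable, and there are countably many of them.\<close>

lemma mhss_imp_Lindelof_space:
  assumes "mhss X F"
  shows "Lindelof_space X"
proof -
  have fil: "filtered_space X F"
    and man: "\<And>i. topological_manifold i (subtopology X (stratum F i))"
    using assms by (auto simp: mhss_def)
  have "stratum F i \<subseteq> topspace X" for i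
    using fil by (auto simp: filtered_space_def stratum_def)
  then have "\<Union>(range (stratum F)) = topspace X"
    using stratum_exists[OF fil] by blast
  moreover have "Lindelof_space (subtopology X (\<Union>(range (stratum F))))"
    by (rule Lindelof_space_Union)
      (use man in \<open>auto simp: topological_manifold_def intro: second_countable_imp_Lindelof_space\<close>)
  ultimately show ?thesis by simp
qed

section \<open>Pushing outward\<close>

text \<open>The downward translation of \<open>Y \<times> \<real>\<close> is to be lifted for all times at once, whereas an
  approximate fibration lifts homotopies over the unit interval. The way out is to treat the running
  time \<open>T\<close> as part of the test space: over \<open>Z \<times> [0, \<infinity>)\<close> the homotopy with parameter \<open>s\<close> descends by
  \<open>s * T\<close>. Evaluating its lift at \<open>s = min 1 T\<close> gives the starting map at \<open>T = 0\<close>, where the lift is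
  constrained, and the full descent for \<open>T \<ge> 1\<close>. The approximation parameter is selected continuously
  on \<open>Z \<times> [0, \<infinity>)\<close> so that the error is at most \<open>1\<close>. As only one lift is used, errors do not
  accumulate.\<close>

lemma msaf_outward_push:
  fixes Z :: "'z topology"
  assumes msaf: "msaf A FA (prod_topology Y euclideanreal) (times_line_filtration FY) p"
    and \<phi>: "continuous_map Y euclideanreal \<phi>" and f: "continuous_map Z A f"
  obtains H where "continuous_map (prod_topology Z (top_of_set {0..})) A H"
    and "stratum_preserving_along (topspace Z) {0..} FA H"
    and "\<And>z. z \<in> topspace Z \<Longrightarrow> H (z, 0) = f z"
    and "\<And>z T. z \<in> topspace Z \<Longrightarrow> 0 \<le> T \<Longrightarrow> \<phi> (fst (p (f z))) \<le> \<phi> (fst (p (H (z, T)))) + 1"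
    and "\<And>z T. z \<in> topspace Z \<Longrightarrow> 0 \<le> T \<Longrightarrow>
           snd (p (H (z, T))) \<le> snd (p (f z)) - min 1 T * T + 1"
proof -
  let ?B = "prod_topology Y euclideanreal"
  define W where "W = prod_topology Z (top_of_set {0::real..})"
  have topW: "topspace W = topspace Z \<times> {0..}" by (simp add: W_def)
  have p: "continuous_map A ?B p" and filA: "filtered_space A FA"
    and filB: "filtered_space ?B (times_line_filtration FY)"
    using msaf by (auto simp: msaf_def compact_preimage_map_def mhss_def)
  have fW: "continuous_map W A (\<lambda>w. f (fst w))"
    using continuous_map_compose[OF continuous_map_fst f] unfolding W_def by (simp add: o_def)
  have pfW: "continuous_map W ?B (\<lambda>w. p (f (fst w)))"
    using continuous_map_compose[OF fW p] by (simp add: o_def)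
  have TW: "continuous_map W euclideanreal snd"
    unfolding W_def by (metis continuous_map_into_fulltopology continuous_map_snd)
  have pf1: "continuous_map W Y (\<lambda>w. fst (p (f (fst w))))"
    and pf2: "continuous_map W euclideanreal (\<lambda>w. snd (p (f (fst w))))"
    using continuous_map_fst_of[OF pfW] continuous_map_snd_of[OF pfW] by (simp_all add: o_def)
  define D where "D = (\<lambda>(w :: 'z \<times> real, s :: real). (fst (p (f (fst w))), snd (p (f (fst w))) - s * snd w))"
  have WI1: "continuous_map (prod_topology W unit_interval) W fst" by (rule continuous_map_fst)
  have WI2: "continuous_map (prod_topology W unit_interval) euclideanreal snd"
    by (metis continuous_map_into_fulltopology continuous_map_snd)
  have "continuous_map (prod_topology W unit_interval) ?B
      (\<lambda>x. (fst (p (f (fst (fst x)))), snd (p (f (fst (fst x)))) - snd x * snd (fst x)))"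
  proof (intro continuous_map_pairedI continuous_map_diff continuous_map_real_mult WI2)
    show "continuous_map (prod_topology W unit_interval) Y (\<lambda>x. fst (p (f (fst (fst x)))))"
      using continuous_map_compose[OF WI1 pf1] by (simp add: o_def)
    show "continuous_map (prod_topology W unit_interval) euclideanreal (\<lambda>x. snd (p (f (fst (fst x)))))"
      using continuous_map_compose[OF WI1 pf2] by (simp add: o_def)
    show "continuous_map (prod_topology W unit_interval) euclideanreal (\<lambda>x. snd (fst x))"
      using continuous_map_compose[OF WI1 TW] by (simp add: o_def)
  qed
  then have D: "continuous_map (prod_topology W unit_interval) ?B D"
    by (simp add: D_def case_prod_unfold)
  have "stratum_preserving_along (topspace W) {0..1} (times_line_filtration FY) D"
    unfolding stratum_preserving_along_def
  proof
    fix w assume w: "w \<in> topspace W"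
    have "p (f (fst w)) \<in> topspace ?B"
      using continuous_map_funspace[OF pfW] w by blast
    then obtain j where j: "p (f (fst w)) \<in> stratum (times_line_filtration FY) j"
      using stratum_exists[OF filB] by blast
    then obtain i where i: "j = Suc i"
      by (cases j) (auto simp: stratum_times_line_filtration)
    show "\<exists>i. D ` ({w} \<times> {0..1}) \<subseteq> stratum (times_line_filtration FY) i"
      using j unfolding i
      by (intro exI[of _ "Suc i"]) (auto simp: stratum_times_line_filtration D_def)
  qed
  with D have "stratum_preserving_homotopy W ?B (times_line_filtration FY) D"
    by (simp add: stratum_preserving_homotopy_def)
  moreover have "\<forall>w\<in>topspace W. D (w, 0) = p (f (fst w))" by (simp add: D_def)
  ultimately obtain G where
    G: "continuous_map (prod_topology W (prod_topology unit_interval (top_of_set {0..<1}))) A G"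
    and Gstr: "stratum_preserving_along (topspace W) ({0..1} \<times> {0..<1}) FA G"
    and G0: "\<forall>w\<in>topspace W. \<forall>t\<in>{0..<1}. G (w, 0, t) = f (fst w)"
    and GD: "continuous_map (prod_topology W (prod_topology unit_interval unit_interval)) ?B
         (\<lambda>(w, s, t). if t < 1 then p (G (w, s, t)) else D (w, s))"
    using msaf_lifting[OF msaf, of W] fW unfolding stratified_approximate_lifting_wrt_def by blast
  define \<sigma> where "\<sigma> = (\<lambda>w :: 'z \<times> real. min 1 (snd w))"
  have \<sigma>: "continuous_map W unit_interval \<sigma>"
    unfolding \<sigma>_def continuous_map_in_subtopology
    by (intro conjI continuous_map_real_min TW) (auto simp: topW)
  \<comment> \<open>the image of the lift, completed at time 1 by the lifted homotopy and restricted to \<open>s = \<sigma> w\<close>\<close>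
  define Q where "Q = (\<lambda>(w, t). if t < 1 then p (G (w, \<sigma> w, t)) else D (w, \<sigma> w))"
  have "continuous_map (prod_topology W unit_interval) (prod_topology W (prod_topology unit_interval unit_interval))
      (\<lambda>x. (fst x, \<sigma> (fst x), snd x))"
    using continuous_map_compose[OF WI1 \<sigma>]
    by (intro continuous_map_pairedI WI1 continuous_map_snd) (simp add: o_def)
  from continuous_map_compose[OF this GD] have Q: "continuous_map (prod_topology W unit_interval) ?B Q"
    by (simp add: Q_def o_def case_prod_unfold cong: if_cong)
  have "continuous_map (prod_topology W unit_interval) (prod_topology W unit_interval)
      (\<lambda>x. (fst x, \<sigma> (fst x)))"
    using continuous_map_compose[OF WI1 \<sigma>]
    by (intro continuous_map_pairedI WI1) (simp add: o_def)
  from continuous_map_compose[OF this D]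
  have D\<sigma>: "continuous_map (prod_topology W unit_interval) ?B (\<lambda>x. D (fst x, \<sigma> (fst x)))"
    by (simp add: o_def)
  define e where "e = (\<lambda>x. \<bar>\<phi> (fst (Q x)) - \<phi> (fst (D (fst x, \<sigma> (fst x))))\<bar> +
      \<bar>snd (Q x) - snd (D (fst x, \<sigma> (fst x)))\<bar>)"
  have "continuous_map (prod_topology W unit_interval) euclideanreal e"
    unfolding e_def
    using continuous_map_compose[OF continuous_map_fst_of[OF Q] \<phi>] continuous_map_snd_of[OF Q]
      continuous_map_compose[OF continuous_map_fst_of[OF D\<sigma>] \<phi>] continuous_map_snd_of[OF D\<sigma>]
    by (intro continuous_map_add continuous_map_real_abs continuous_map_diff) (simp_all add: o_def)
  moreover have "e (w, 1) = 0" for w by (simp add: e_def Q_def)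
  ultimately obtain \<delta> where \<delta>: "continuous_map W (top_of_set {0..<1}) \<delta>"
    and e\<delta>: "\<And>w. w \<in> topspace W \<Longrightarrow> e (w, \<delta> w) \<le> 1"
    using continuous_small_error_selection by blast
  have \<delta>01: "\<delta> w \<in> {0..<1}" if "w \<in> topspace W" for w
    using \<delta> that by (auto simp: continuous_map_in_subtopology)
  have \<sigma>01: "\<sigma> w \<in> {0..1}" if "w \<in> topspace W" for w
    using \<sigma> that by (auto simp: continuous_map_in_subtopology)
  define H where "H = (\<lambda>w. G (w, \<sigma> w, \<delta> w))"
  have H0: "H (z, 0) = f z" if "z \<in> topspace Z" for z
    using G0 \<delta>01[of "(z, 0)"] that by (simp add: H_def \<sigma>_def topW)
  have bound: "\<bar>\<phi> (fst (p (H w))) - \<phi> (fst (p (f (fst w))))\<bar> +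
      \<bar>snd (p (H w)) - (snd (p (f (fst w))) - \<sigma> w * snd w)\<bar> \<le> 1" if "w \<in> topspace W" for w
    using e\<delta>[OF that] \<delta>01[OF that] by (simp add: e_def Q_def D_def H_def)
  show ?thesis
  proof
    have "continuous_map W (prod_topology W (prod_topology unit_interval (top_of_set {0..<1})))
        (\<lambda>w. (w, \<sigma> w, \<delta> w))"
      by (intro continuous_map_pairedI \<sigma> \<delta>) simp
    from continuous_map_compose[OF this G] show "continuous_map (prod_topology Z (top_of_set {0..})) A H"
      by (simp add: H_def o_def W_def)
    show "stratum_preserving_along (topspace Z) {0..} FA H"
      unfolding stratum_preserving_along_def
    proof
      fix z assume z: "z \<in> topspace Z"
      \<comment> \<open>The lift stays in one stratum over each \<open>(z, T)\<close>; these strata agree for all \<open>T\<close>, as each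
        contains \<open>f z\<close>.\<close>
      then have "f z \<in> topspace A" using continuous_map_funspace[OF f] by blast
      then obtain i where i: "f z \<in> stratum FA i" using stratum_exists[OF filA] by blast
      have "H (z, T) \<in> stratum FA i" if "0 \<le> T" for T
      proof -
        have w: "(z, T) \<in> topspace W" using z that by (simp add: topW)
        then obtain j where j: "G ` ({(z, T)} \<times> ({0..1} \<times> {0..<1})) \<subseteq> stratum FA j"
          using Gstr unfolding stratum_preserving_along_def by blast
        moreover have "G ((z, T), 0, 0) = f z" using G0 w by simp
        ultimately have "f z \<in> stratum FA j" by force
        then have "j = i" using stratum_unique[OF filA] i by blast
        then show ?thesis using j \<sigma>01[OF w] \<delta>01[OF w] unfolding H_def by blast
      qed
      then show "\<exists>i. H ` ({z} \<times> {0..}) \<subseteq> stratum FA i" by (intro exI[of _ i]) auto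
    qed
    show "H (z, 0) = f z" if "z \<in> topspace Z" for z by (rule H0[OF that])
    fix z T assume "z \<in> topspace Z" "0 \<le> (T::real)"
    then have "(z, T) \<in> topspace W" by (simp add: topW)
    from bound[OF this]
    show "\<phi> (fst (p (f z))) \<le> \<phi> (fst (p (H (z, T)))) + 1"
      and "snd (p (H (z, T))) \<le> snd (p (f z)) - min 1 T * T + 1"
      by (auto simp: \<sigma>_def)
  qed
qed

section \<open>Outward tameness of approximate tubular neighborhoods\<close>

theorem proposition6p6:
  fixes X :: "'a topology" and F :: "nat \<Rightarrow> 'a set" and Y N :: "'a set"
  assumes "mhss X F"
    and "pure_subset X F Y"
    and "approximate_tubular_neighborhood X F Y N"
  shows "outwardly_stratified_tame TYPE('z) X F Y N"
proof -
  let ?W = "subtopology X (N - Y)" and ?Y = "subtopology X Y" and ?N = "subtopology X N"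
  have Ycl: "closedin X Y" using assms(2) by (simp add: pure_subset_def)
  have X: "locally_compact_space X" "metrizable_space X" using assms(1) by (auto simp: mhss_def)
  have nbhd: "is_neighborhood X Y N"
    using assms(3) by (simp add: approximate_tubular_neighborhood_def)
  then have NX: "N \<subseteq> topspace X" and YN: "Y \<subseteq> N" by (auto simp: is_neighborhood_def)
  obtain p where msaf: "msaf ?W (restrict_filtration F (N - Y)) (prod_topology ?Y euclideanreal)
            (times_line_filtration (restrict_filtration F Y)) p"
    and hom: "homeomorphic_map (teardrop ?W ?Y p) ?N (case_sum id id)"
    using assms(3) unfolding approximate_tubular_neighborhood_def by blast
  have pp: "compact_preimage_map ?W (prod_topology ?Y euclideanreal) p"
    using msaf by (simp add: msaf_def)
  then have pc: "continuous_map ?W (prod_topology ?Y euclideanreal) p"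
    by (simp add: compact_preimage_map_def)
  have topW: "topspace ?W = N - Y" using NX by auto
  have "completely_regular_space ?Y"
    using X(2) by (auto intro!: metrizable_imp_completely_regular_space metrizable_space_subtopology)
  then obtain \<phi> where \<phi>: "continuous_map ?Y euclideanreal \<phi>"
    and \<phi>K: "\<And>b. compactin ?Y {y \<in> topspace ?Y. \<phi> y \<le> b}"
    using exhausting_function_exists[of ?Y] locally_compact_space_closed_subset[OF X(1) Ycl]
      Lindelof_space_closedin_subtopology[OF mhss_imp_Lindelof_space[OF assms(1)] Ycl] by blast
  have sub: "compactin ?N ({x \<in> N - Y. \<phi> (fst (p x)) \<le> b \<and> a \<le> snd (p x)} \<union> {y \<in> Y. \<phi> y \<le> b})" for a b
  proof -
    have img: "fst (p x) \<in> topspace ?Y" if "x \<in> N - Y" for x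
      using continuous_map_funspace[OF continuous_map_fst_of[OF pc]] that topW by (simp add: Pi_iff)
    from image_compactin[OF compactin_teardrop_tail[OF pp \<phi>K[of b], of a] homeomorphic_imp_continuous_map[OF hom]]
    have "compactin ?N ({x \<in> topspace ?W. fst (p x) \<in> {y \<in> topspace ?Y. \<phi> y \<le> b} \<and> a \<le> snd (p x)} \<union> {y \<in> topspace ?Y. \<phi> y \<le> b})"
      by (simp add: image_Un image_image)
    moreover have "{x \<in> topspace ?W. fst (p x) \<in> {y \<in> topspace ?Y. \<phi> y \<le> b} \<and> a \<le> snd (p x)} \<union> {y \<in> topspace ?Y. \<phi> y \<le> b}
      = {x \<in> N - Y. \<phi> (fst (p x)) \<le> b \<and> a \<le> snd (p x)} \<union> {y \<in> Y. \<phi> y \<le> b}"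
      unfolding topW using img YN NX by auto
    ultimately show ?thesis by simp
  qed
  have bnd: "\<exists>a b. \<forall>x\<in>K - Y. \<phi> (fst (p x)) \<le> b \<and> a \<le> snd (p x)" if K: "compactin ?N K" for K
  proof -
    let ?K = "{x \<in> topspace (teardrop ?W ?Y p). case_sum id id x \<in> K}"
    have KN: "K \<subseteq> N" using compactin_subset_topspace[OF K] by simp
    have "case_sum id id ` topspace (teardrop ?W ?Y p) = N"
      using homeomorphic_imp_surjective_map[OF hom] NX by auto
    then have "case_sum id id ` ?K = K" using KN by auto
    then have "compactin (teardrop ?W ?Y p) ?K"
      using homeomorphic_map_compactness[OF hom, of ?K] K by auto
    from teardrop_compact_bounds[OF pc this \<phi>] obtain a b
      where "\<And>x. Inl x \<in> ?K \<Longrightarrow> \<phi> (fst (p x)) \<le> b \<and> a \<le> snd (p x)" by blast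
    moreover have "Inl x \<in> ?K" if "x \<in> K - Y" for x
      using that KN topW unfolding topspace_teardrop[OF pc] by auto
    ultimately show ?thesis by blast
  qed
  show ?thesis
    unfolding outwardly_stratified_tame_def
  proof (intro conjI nbhd allI impI, elim conjE)
    fix Z :: "'z topology" and f
    assume f: "compact_preimage_map Z ?N f" "f ` topspace Z \<subseteq> N - Y"
    let ?P = "prod_topology Z (top_of_set {0::real..})"
    have fN: "continuous_map Z ?N f" using f(1) by (simp add: compact_preimage_map_def)
    have fW: "continuous_map Z ?W f"
      using fN f(2) by (auto simp: continuous_map_in_subtopology)
    obtain H where H: "continuous_map ?P ?W H"
      and Hs: "stratum_preserving_along (topspace Z) {0..} (restrict_filtration F (N - Y)) H"
      and H0: "\<And>z. z \<in> topspace Z \<Longrightarrow> H (z, 0) = f z"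
      and H1: "\<And>z T. z \<in> topspace Z \<Longrightarrow> 0 \<le> T \<Longrightarrow> \<phi> (fst (p (f z))) \<le> \<phi> (fst (p (H (z, T)))) + 1"
      and H2: "\<And>z T. z \<in> topspace Z \<Longrightarrow> 0 \<le> T \<Longrightarrow>
           snd (p (H (z, T))) \<le> snd (p (f z)) - min 1 T * T + 1"
      using msaf_outward_push[OF msaf \<phi> fW] by blast
    have HN: "continuous_map ?P ?N H" and HW: "H ` (topspace Z \<times> {0..}) \<subseteq> N - Y"
      using H by (auto simp: continuous_map_in_subtopology)
    have "compactin ?P {x \<in> topspace ?P. H x \<in> K}" if K: "compactin ?N K" for K
    proof -
      obtain a b where ab: "\<And>x. x \<in> K - Y \<Longrightarrow> \<phi> (fst (p x)) \<le> b \<and> a \<le> snd (p x)"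
        using bnd[OF K] by blast
      \<comment> \<open>The bounds on \<open>K\<close> relaxed by the error of the lift; descending only lowers points, so the
        lower bound on the height holds for the starting point as well.\<close>
      let ?L = "{x \<in> N - Y. \<phi> (fst (p x)) \<le> b + 1 \<and> a - 1 \<le> snd (p x)} \<union> {y \<in> Y. \<phi> y \<le> b + 1}"
      let ?S = "{z \<in> topspace Z. f z \<in> ?L}"
      have S: "compactin Z ?S"
        using f(1) sub unfolding compact_preimage_map_def by blast
      have "continuous_map Z euclideanreal (\<lambda>z. snd (p (f z)))"
        using continuous_map_snd_of[OF continuous_map_compose[OF fW pc]] by (simp add: o_def)
      from image_compactin[OF S this] have "bounded ((\<lambda>z. snd (p (f z))) ` ?S)"
        by (simp add: compact_imp_bounded)
      then obtain R where "\<forall>z\<in>?S. \<bar>snd (p (f z))\<bar> \<le> R"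
        unfolding bounded_real ball_simps by (elim exE)
      then have R: "snd (p (f z)) \<le> R" if "z \<in> ?S" for z
        using that by (blast intro: order_trans[OF abs_ge_self])
      \<comment> \<open>A point that starts at height at most \<open>R\<close> has sunk below height \<open>a\<close> after time
        \<open>R - a + 1\<close>, provided that the descent has full speed, that is after time 1.\<close>
      let ?C = "?S \<times> {0..max 1 (R - a + 1)}"
      have "{x \<in> topspace ?P. H x \<in> K} \<subseteq> ?C"
      proof clarify
        fix z T assume "(z, T) \<in> topspace ?P" "H (z, T) \<in> K"
        then have z: "z \<in> topspace Z" "0 \<le> T" and "H (z, T) \<in> K - Y" using HW by auto
        from ab[OF this(3)] H1[OF z] H2[OF z]
        have *: "\<phi> (fst (p (f z))) \<le> b + 1" "a - 1 + min 1 T * T \<le> snd (p (f z))" by auto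
        have "0 \<le> min 1 T * T" using z by simp
        with *(2) have "a - 1 \<le> snd (p (f z))" by linarith
        moreover have "f z \<in> N - Y" using z f(2) by blast
        ultimately have zS: "z \<in> ?S" using z *(1) by simp
        have "T \<le> max 1 (R - a + 1)"
          using *(2) R[OF zS] by (cases "T \<le> 1") auto
        then show "z \<in> ?S \<and> T \<in> {0..max 1 (R - a + 1)}" using z zS by simp
      qed
      moreover have "compactin ?P ?C"
        using S by (auto simp: compactin_Times compactin_subtopology)
      moreover have "closedin ?P {x \<in> topspace ?P. H x \<in> K}"
        using closedin_continuous_map_preimage[OF HN] compactin_imp_closedin[OF _ K]
          Hausdorff_space_subtopology metrizable_imp_Hausdorff_space[OF X(2)] by blast
      ultimately show ?thesis using closed_compactin by blast
    qed
    with HN have Hp: "compact_preimage_map ?P ?N H" by (simp add: compact_preimage_map_def)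
    have "stratum_preserving_along (topspace Z) {0..} (restrict_filtration F N) H"
      using Hs unfolding stratum_preserving_along_def stratum_restrict_filtration by blast
    then show "\<exists>H. compact_preimage_map ?P ?N H \<and>
             stratum_preserving_along (topspace Z) {0..} (restrict_filtration F N) H \<and>
             H ` (topspace Z \<times> {0..}) \<subseteq> N - Y \<and>
             (\<forall>z\<in>topspace Z. H (z, 0) = f z)"
      using Hp HW H0 by blast
  qed
qed

end
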